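(* Let $n$ be a positive integer and let $P$ be a set of monic irreducible polynomials of degree $n$ in $\mathbb{Z}[X]$. Let $\mathcal{A}(P)$ be the set of all roots in $\overline{\mathbb{Q}}$ of the polynomials in $P$. Then the integral closure (in the quotient field $\mathbb{Q}(X)$) of the ring $\mathrm{Int}(M_n^P(\mathbb{Z}),M_n(\mathbb{Z}))$ is $\mathrm{Int}_{\mathbb{Q}}(\mathcal{A}(P),\mathcal{A}_n)$.
   Context: $M_n(\mathbb{Z})$ is the ring of $n\times n$ integer matrices, $M_n^P(\mathbb{Z})$ is the set of matrices in $M_n(\mathbb{Z})$ whose characteristic polynomial belongs to $P$, and $\mathrm{Int}(M_n^P(\mathbb{Z}),M_n(\mathbb{Z}))=\{f\in\mathbb{Q}[X]\mid f(M)\in M_n(\mathbb{Z})\ \text{for all } M\in M_n^P(\mathbb{Z})\}$. $\mathcal{A}_n$ is the set of all algebraic integers of degree less than or equal to $n$ over $\mathbb{Q}$ in a fixed algebraic closure $\overline{\mathbb{Q}}$, and for $\mathcal{A}\subseteq\mathcal{A}_n$, $\mathrm{Int}_{\mathbb{Q}}(\mathcal{A},\mathcal{A}_n)=\{f\in\mathbb{Q}[X]\mid f(\mathcal{A})\subset\mathcal{A}_n\}$. *)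

theory Defs
  imports
    "HOL-Algebra.Algebraic_Closure_Type"
    "HOL-Computational_Algebra.Computational_Algebra"
    "Jordan_Normal_Form.Char_Poly"
begin

text \<open>
  The algebraic closure of the rationals is the library type \<^typ>\<open>rat alg_closure\<close>, and
  \<open>\<rat>(X)\<close> is \<^typ>\<open>rat poly fract\<close>, into which \<open>\<rat>[X]\<close> embeds by \<^const>\<open>to_fract\<close>.
\<close>

definition integral_closure :: "'a::comm_ring_1 set \<Rightarrow> 'a set" where
  "integral_closure R = {x. \<exists>p. lead_coeff p = 1 \<and> (\<forall>i. coeff p i \<in> R) \<and> poly p x = 0}"

text \<open>The value \<open>f(M) = c\<^sub>0 I + c\<^sub>1 M + \<dots> + c\<^sub>d M\<^sup>d\<close> at a square matrix, given entry by entry.\<close>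

definition poly_mat :: "'a::comm_ring_1 poly \<Rightarrow> 'a mat \<Rightarrow> 'a mat" where
  "poly_mat f M = mat (dim_row M) (dim_row M)
     (\<lambda>(i, j). \<Sum>k\<le>degree f. coeff f k * (M ^\<^sub>m k) $$ (i, j))"

definition int_mats_charpoly :: "nat \<Rightarrow> int poly set \<Rightarrow> int mat set" where
  "int_mats_charpoly n P = {M \<in> carrier_mat n n. char_poly M \<in> P}"

text \<open>\<open>M\<^sub>n(\<int>)\<close> as a subset of \<open>M\<^sub>n(\<rat>)\<close>, where the values \<open>f(M)\<close> live.\<close>

definition int_mats_in_rat :: "nat \<Rightarrow> rat mat set" where
  "int_mats_in_rat n = map_mat of_int ` carrier_mat n n"

definition Int_mats :: "nat \<Rightarrow> int poly set \<Rightarrow> rat poly set" where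
  "Int_mats n P = {f. \<forall>M \<in> int_mats_charpoly n P.
     poly_mat f (map_mat of_int M) \<in> int_mats_in_rat n}"

text \<open>Only meaningful for algebraic \<open>x\<close>, which is every element of \<^typ>\<open>rat alg_closure\<close>.\<close>

definition min_poly_rat :: "rat alg_closure \<Rightarrow> rat poly" where
  "min_poly_rat x = (THE p. lead_coeff p = 1 \<and> irreducible p \<and> poly (map_poly of_rat p) x = 0)"

definition alg_ints_deg_le :: "nat \<Rightarrow> rat alg_closure set" where
  "alg_ints_deg_le n = {x. algebraic_int x \<and> degree (min_poly_rat x) \<le> n}"

definition roots_of_set :: "int poly set \<Rightarrow> rat alg_closure set" where
  "roots_of_set P = {x. \<exists>p \<in> P. poly (map_poly of_int p) x = 0}"

definition Int_rat :: "rat alg_closure set \<Rightarrow> rat alg_closure set \<Rightarrow> rat poly set" where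
  "Int_rat A B = {f. \<forall>x \<in> A. poly (map_poly of_rat f) x \<in> B}"

end

theory Submission
  imports Defs "Berlekamp_Zassenhaus.Factor_Bound"
begin

text \<open>
  Let \<open>\<alpha>\<close> be a root of \<open>p \<in> P\<close> with companion matrix \<open>C\<close>. If \<open>a\<close> takes integral values on the matrices,
  then multiplication by \<open>a(\<alpha>)\<close> preserves the lattice \<open>\<int>[\<alpha>]\<close>, because \<open>a(C)\<close> is integral; so if \<open>f\<close> is
  integral over such \<open>a\<close>, then \<open>f(\<alpha>)\<close> preserves a finitely generated \<open>\<int>\<close>-module
  \<open>\<Sum>\<^sub>k f(\<alpha>)\<^sup>k \<int>[\<alpha>]\<close>. Conversely, write \<open>d f \<in> \<int>[X]\<close>. For \<open>M\<close> with characteristic polynomial \<open>p\<close>, the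
  minimal polynomial \<open>h \<in> \<int>[T]\<close> of \<open>f(\<alpha>)\<close> kills \<open>f(M)\<close> by Cayley--Hamilton, so all elements of \<open>\<int>[f(M)]\<close>
  have denominator dividing \<open>d\<^sup>n\<close>. Modulo \<open>2 d\<^sup>n\<close> there are only finitely many possible \<open>h\<close>; the product
  \<open>\<phi>\<close> of monic representatives makes \<open>\<phi>(f(M))\<close> integral for every \<open>M\<close>, and \<open>f\<close> is a root of the monic
  polynomial \<open>\<phi>(T) - \<phi>(f)\<close>. The factor 2 ensures a modulus greater than 1, so that leading
  coefficients stay 1 under reduction.
\<close>

section \<open>Minimal polynomials over the rationals and Gauss's lemma\<close>

interpretation of_rat_poly_hom: map_poly_inj_idom_hom of_rat ..

text \<open>Otherwise \<open>q\<close> and \<open>u\<close> are coprime, and a Bezout identity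
  evaluated at \<open>x\<close> reads 0 = 1.\<close>

lemma irreducible_dvd_of_common_root:
  fixes q u :: "rat poly" and x :: "'a::field_char_0"
  assumes q: "irreducible q"
    and "poly (map_poly of_rat q) x = 0" "poly (map_poly of_rat u) x = 0"
  shows "q dvd u"
proof (rule ccontr)
  assume "\<not> q dvd u"
  then have "Rings.coprime q u"
    using q by (meson irreducible_imp_prime_elem prime_elem_imp_coprime)
  then obtain a b where ab: "a * q + b * u = 1"
    by (metis bezout_coefficients_fst_snd coprime_iff_gcd_eq_1)
  have "poly (map_poly of_rat (a * q + b * u)) x = 0"
    using assms by (simp add: hom_distribs)
  then show False
    by (simp add: ab)
qed

text \<open>Gauss's lemma: a monic integer polynomial is primitive, so a factorization over the
  rationals would give one over the integers.\<close>

lemma irreducible_of_int_poly: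
  assumes "irreducible p" "lead_coeff p = 1" "degree p > 0"
  shows "irreducible (of_int_poly p :: rat poly)"
proof -
  have "content p = 1"
    using assms(2) by (metis content_dvd_coeff is_unit_normalize normalize_content)
  then have "irreducible\<^sub>d p"
    using assms by (simp add: irreducible_primitive_connect)
  then show ?thesis
    using irreducible\<^sub>d_int_rat by simp
qed

lemma min_poly_rat_eqI:
  assumes "lead_coeff q = 1" "irreducible q" "poly (map_poly of_rat q) x = 0"
  shows "min_poly_rat x = q"
  unfolding min_poly_rat_def
proof (rule the_equality)
  fix r assume r: "lead_coeff r = 1 \<and> irreducible r \<and> poly (map_poly of_rat r) x = 0"
  then have "q dvd r" "r dvd q"
    using assms by (blast intro: irreducible_dvd_of_common_root)+
  then show "r = q"
    using r assms by (metis poly_dvd_antisym)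
qed (use assms in simp)

text \<open>Splitting \<open>u\<close> into factors of smaller degree ends at an irreducible factor
  that vanishes at \<open>x\<close>. Its monic multiple meets the description of
  \<open>min_poly_rat x\<close>, which is unique by \<open>min_poly_rat_eqI\<close>.\<close>

lemma min_poly_rat:
  assumes "u \<noteq> 0" "poly (map_poly of_rat u) x = 0"
  shows "lead_coeff (min_poly_rat x) = 1" "irreducible (min_poly_rat x)"
    "poly (map_poly of_rat (min_poly_rat x)) x = 0" "min_poly_rat x dvd u"
proof -
  have "\<exists>q. irreducible q \<and> poly (map_poly of_rat q) x = 0 \<and> q dvd u"
    using assms
  proof (induction "degree u" arbitrary: u rule: less_induct)
    case less
    show ?case
    proof (cases "irreducible u")
      case False
      have "degree u \<noteq> 0"
      proof
        assume "degree u = 0"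
        then obtain c where "u = [:c:]"
          by (metis degree_eq_zeroE)
        then show False
          using less.prems by simp
      qed
      with False obtain a b where ab: "u = a * b" "degree a < degree u" "degree b < degree u"
        by (metis irreducible\<^sub>dI irreducible_connect_field reducible\<^sub>dE neq0_conv)
      have "poly (map_poly of_rat a) x = 0 \<or> poly (map_poly of_rat b) x = 0"
        using less.prems by (simp add: ab(1) hom_distribs)
      moreover have "a \<noteq> 0" "b \<noteq> 0"
        using less.prems ab(1) by auto
      ultimately show ?thesis
        using less.hyps[OF ab(2)] less.hyps[OF ab(3)] ab(1) by (meson dvd_mult dvd_mult2)
    qed (use less.prems in auto)
  qed
  then obtain q where q: "irreducible q" "poly (map_poly of_rat q) x = 0" "q dvd u"
    by blast
  define r where "r = smult (inverse (lead_coeff q)) q"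
  have "q \<noteq> 0"
    using q(3) assms(1) by auto
  then have r: "lead_coeff r = 1" "irreducible r" "poly (map_poly of_rat r) x = 0" "r dvd u"
    using q by (auto simp: r_def hom_distribs smult_dvd_iff)
  then have "min_poly_rat x = r"
    by (intro min_poly_rat_eqI)
  then show "lead_coeff (min_poly_rat x) = 1" "irreducible (min_poly_rat x)"
    "poly (map_poly of_rat (min_poly_rat x)) x = 0" "min_poly_rat x dvd u"
    using r by auto
qed

text \<open>By Gauss's lemma the primitive integer multiple \<open>h\<close> of the minimal
  polynomial divides the monic \<open>g\<close> already over the integers, so its leading
  coefficient is a unit.\<close>

lemma min_poly_rat_algebraic_int:
  assumes "algebraic_int x"
  obtains h :: "int poly" where "lead_coeff h = 1" "min_poly_rat x = of_int_poly h"
proof -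
  from assms obtain g :: "int poly" where g: "poly (of_int_poly g) x = 0" "lead_coeff g = 1"
    by (auto simp: algebraic_int_altdef_ipoly)
  have "map_poly of_rat (of_int_poly g :: rat poly) = (of_int_poly g :: rat alg_closure poly)"
    by (simp add: map_poly_map_poly o_def)
  moreover have "(of_int_poly g :: rat poly) \<noteq> 0"
    using g(2) by auto
  ultimately have m: "lead_coeff (min_poly_rat x) = 1" "min_poly_rat x dvd of_int_poly g"
    using g(1) min_poly_rat[of "of_int_poly g" x] by auto
  obtain r where r: "(of_int_poly g :: rat poly) = min_poly_rat x * r"
    using m(2) by blast
  obtain d h where dh: "rat_to_normalized_int_poly (min_poly_rat x) = (d, h)"
    by fastforce
  note n = rat_to_normalized_int_poly[OF dh]
  obtain s where "g = h * smult (content g) s"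
    using rat_to_int_factor_explicit[OF r dh] by blast
  then have "lead_coeff h dvd 1"
    using g(2) by (metis dvd_triv_left lead_coeff_mult)
  \<comment> \<open>The minimal polynomial is \<open>d\<close> times \<open>h\<close> with
    \<open>d\<close> positive; this excludes leading coefficient -1.\<close>
  moreover have "d * of_int (lead_coeff h) = 1"
    using m(1) by (subst (asm) (1 2) n(1)) (simp split: if_splits)
  then have "lead_coeff h > 0"
    using n(2) zero_less_mult_pos[of d "of_int (lead_coeff h)"] by simp
  ultimately have "lead_coeff h = 1"
    by auto
  then show ?thesis
    using that n(1) \<open>d * of_int (lead_coeff h) = 1\<close> by simp
qed

section \<open>Eigenvector relations and the determinant trick\<close>

lemma char_poly_root_of_eigenrelation:
  fixes w :: "nat \<Rightarrow> 'b::field" and M :: "'a::comm_ring_1 mat"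
  assumes h: "comm_ring_hom h" and M: "M \<in> carrier_mat n n"
    and w: "i0 < n" "w i0 \<noteq> 0"
    and eq: "\<And>i. i < n \<Longrightarrow> y * w i = (\<Sum>j<n. h (M $$ (i, j)) * w j)"
  shows "poly (map_poly h (char_poly M)) y = 0"
proof -
  interpret comm_ring_hom h by (rule h)
  have "eigenvector (map_mat h M) (vec n w) y"
    unfolding eigenvector_def
  proof (intro conjI)
    show "vec n w \<noteq> 0\<^sub>v (dim_row (map_mat h M))"
      using w M by (metis carrier_matD(1) index_map_mat(2) index_vec index_zero_vec(1))
    show "map_mat h M *\<^sub>v vec n w = y \<cdot>\<^sub>v vec n w"
      using M eq by (intro eq_vecI) (auto simp: scalar_prod_def lessThan_atLeast0)
  qed (use M in auto)
  then have "eigenvalue (map_mat h M) y"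
    unfolding eigenvalue_def by blast
  then show ?thesis
    using M eigenvalue_root_char_poly[of "map_mat h M" n y] char_poly_hom[OF M] by simp
qed

text \<open>Multiplication by \<open>y\<close> preserves the span of the \<open>w i\<close> and acts
  there through \<open>A\<close>, so the characteristic polynomial of \<open>A\<close> vanishes at
  \<open>y\<close>. The index set is arbitrary because the family is later indexed by pairs.\<close>

lemma monic_root_of_stable_span:
  fixes w :: "'i \<Rightarrow> 'b::field" and A :: "'i \<Rightarrow> 'i \<Rightarrow> 'a::comm_ring_1"
  assumes h: "comm_ring_hom h" and I: "finite I"
    and w: "i0 \<in> I" "w i0 \<noteq> 0"
    and eq: "\<And>i. i \<in> I \<Longrightarrow> y * w i = (\<Sum>j\<in>I. h (A i j) * w j)"
  obtains q where "lead_coeff q = 1" "degree q = card I" "poly (map_poly h q) y = 0"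
proof -
  obtain e where e: "bij_betw e {..<card I} I"
    using I by (metis ex_bij_betw_nat_finite lessThan_atLeast0)
  define M where "M = mat (card I) (card I) (\<lambda>(i, j). A (e i) (e j))"
  have M: "M \<in> carrier_mat (card I) (card I)"
    by (simp add: M_def)
  obtain k0 where k0: "k0 < card I" "e k0 = i0"
    using e w(1) by (metis bij_betw_iff_bijections lessThan_iff)
  have "poly (map_poly h (char_poly M)) y = 0"
  proof (rule char_poly_root_of_eigenrelation[OF h M, of k0 "w \<circ> e"])
    fix i assume i: "i < card I"
    then have "e i \<in> I"
      using e by (auto simp: bij_betw_def)
    then have "y * w (e i) = (\<Sum>j\<in>I. h (A (e i) j) * w j)"
      by (rule eq)
    also have "\<dots> = (\<Sum>j<card I. h (A (e i) (e j)) * w (e j))"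
      by (rule sum.reindex_bij_betw[OF e, symmetric])
    finally show "y * (w \<circ> e) i = (\<Sum>j<card I. h (M $$ (i, j)) * (w \<circ> e) j)"
      using i by (simp add: M_def)
  qed (use k0 w in auto)
  then show ?thesis
    using that[of "char_poly M"] degree_monic_char_poly[OF M] by simp
qed

section \<open>Companion matrices and powers of a matrix on an eigenvector\<close>

text \<open>The orientation makes the column of powers 1, x, x^2, ... of a root x of a monic
  \<open>p\<close> a right eigenvector with eigenvalue x: the upper rows shift, and the last row
  rewrites the top power.\<close>

definition companion :: "'a::comm_ring_1 poly \<Rightarrow> 'a mat" where
  "companion p = mat (degree p) (degree p)
     (\<lambda>(i, j). if Suc i < degree p then (if j = Suc i then 1 else 0) else - coeff p j)"

lemma companion_carrier [simp]: "companion p \<in> carrier_mat (degree p) (degree p)"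
  by (simp add: companion_def)

lemma companion_eigenrelation:
  fixes x :: "'b::field"
  assumes h: "comm_ring_hom h" and p: "lead_coeff p = 1" "poly (map_poly h p) x = 0"
    and i: "i < degree p"
  shows "x * x ^ i = (\<Sum>j<degree p. h (companion p $$ (i, j)) * x ^ j)"
proof -
  interpret comm_ring_hom h by (rule h)
  have deg: "degree (map_poly h p) = degree p"
    using p(1) by (intro degree_map_poly) auto
  show ?thesis
  proof (cases "Suc i < degree p")
    case True
    then have "(\<Sum>j<degree p. h (companion p $$ (i, j)) * x ^ j)
        = (\<Sum>j<degree p. if j = Suc i then x ^ j else 0)"
      by (intro sum.cong) (auto simp: companion_def)
    then show ?thesis
      using True by simp
  next
    case False
    \<comment> \<open>In the last row the product is \<open>x ^ degree p\<close>, which the equation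
      p(x) = 0 expresses by lower powers.\<close>
    have "0 = (\<Sum>j\<le>degree p. h (coeff p j) * x ^ j)"
      using p(2) by (simp add: poly_altdef deg)
    also have "\<dots> = x ^ degree p + (\<Sum>j<degree p. h (coeff p j) * x ^ j)"
      using p(1) by (simp add: lessThan_Suc_atMost[symmetric])
    finally have "x ^ degree p = (\<Sum>j<degree p. - (h (coeff p j) * x ^ j))"
      by (simp add: sum_negf eq_neg_iff_add_eq_0)
    also have "\<dots> = (\<Sum>j<degree p. h (companion p $$ (i, j)) * x ^ j)"
      using i False by (intro sum.cong) (auto simp: companion_def hom_distribs)
    moreover have "degree p = Suc i"
      using i False by simp
    ultimately show ?thesis
      by simp
  qed
qed

lemma matrix_power_eigenrelation:
  fixes w :: "nat \<Rightarrow> 'b::comm_ring_1"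
  assumes h: "comm_ring_hom h" and M: "M \<in> carrier_mat n n"
    and eq: "\<And>i. i < n \<Longrightarrow> y * w i = (\<Sum>j<n. h (M $$ (i, j)) * w j)" and i: "i < n"
  shows "y ^ k * w i = (\<Sum>j<n. h ((M ^\<^sub>m k) $$ (i, j)) * w j)"
  using i
proof (induction k arbitrary: i)
  case 0
  interpret comm_ring_hom h by (rule h)
  have "(\<Sum>j<n. h ((M ^\<^sub>m 0) $$ (i, j)) * w j) = (\<Sum>j<n. if j = i then w j else 0)"
    using M 0 by (intro sum.cong) auto
  then show ?case
    using 0 by simp
next
  case (Suc k)
  interpret comm_ring_hom h by (rule h)
  have "y ^ Suc k * w i = y * (\<Sum>m<n. h ((M ^\<^sub>m k) $$ (i, m)) * w m)"
    using Suc by (simp add: mult.assoc)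
  also have "\<dots> = (\<Sum>m<n. h ((M ^\<^sub>m k) $$ (i, m)) * (y * w m))"
    by (simp add: sum_distrib_left algebra_simps)
  also have "\<dots> = (\<Sum>m<n. \<Sum>j<n. h ((M ^\<^sub>m k) $$ (i, m)) * (h (M $$ (m, j)) * w j))"
    by (simp add: eq sum_distrib_left)
  also have "\<dots> = (\<Sum>j<n. \<Sum>m<n. h ((M ^\<^sub>m k) $$ (i, m)) * (h (M $$ (m, j)) * w j))"
    by (rule sum.swap)
  also have "\<dots> = (\<Sum>j<n. h ((M ^\<^sub>m Suc k) $$ (i, j)) * w j)"
  proof (intro sum.cong refl)
    fix j assume "j \<in> {..<n}"
    then have "(M ^\<^sub>m Suc k) $$ (i, j) = (\<Sum>m<n. (M ^\<^sub>m k) $$ (i, m) * M $$ (m, j))"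
      using M Suc.prems pow_carrier_mat[OF M, of k]
      by (auto simp: scalar_prod_def lessThan_atLeast0 intro!: sum.cong)
    then show "(\<Sum>m<n. h ((M ^\<^sub>m k) $$ (i, m)) * (h (M $$ (m, j)) * w j))
        = h ((M ^\<^sub>m Suc k) $$ (i, j)) * w j"
      by (simp add: hom_distribs sum_distrib_right mult.assoc)
  qed
  finally show ?case .
qed

section \<open>Entries of polynomial values of matrices, and Cayley-Hamilton\<close>

text \<open>Padding with zero coefficients lets polynomials of different degrees be summed over one
  common range.\<close>

lemma poly_mat_entry:
  assumes "M \<in> carrier_mat n n" "i < n" "j < n" "degree f \<le> N"
  shows "poly_mat f M $$ (i, j) = (\<Sum>k\<le>N. coeff f k * (M ^\<^sub>m k) $$ (i, j))"
proof -
  have "poly_mat f M $$ (i, j) = (\<Sum>k\<le>degree f. coeff f k * (M ^\<^sub>m k) $$ (i, j))"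
    using assms by (simp add: poly_mat_def)
  also have "\<dots> = (\<Sum>k\<le>N. coeff f k * (M ^\<^sub>m k) $$ (i, j))"
    using assms(4) by (intro sum.mono_neutral_left) (auto simp: coeff_eq_0)
  finally show ?thesis .
qed

lemma poly_mat_0_entry:
  assumes "M \<in> carrier_mat n n" "i < n" "j < n"
  shows "poly_mat 0 M $$ (i, j) = 0"
  using assms by (simp add: poly_mat_entry[of M n i j 0 0])

lemma poly_mat_add_entry:
  assumes "M \<in> carrier_mat n n" "i < n" "j < n"
  shows "poly_mat (f + g) M $$ (i, j) = poly_mat f M $$ (i, j) + poly_mat g M $$ (i, j)"
proof -
  define N where "N = max (degree f) (degree g)"
  have "degree f \<le> N" "degree g \<le> N" "degree (f + g) \<le> N"
    by (auto simp: N_def degree_add_le)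
  then show ?thesis
    using assms by (simp add: poly_mat_entry[where N = N] algebra_simps sum.distrib)
qed

lemma poly_mat_smult_entry:
  assumes "M \<in> carrier_mat n n" "i < n" "j < n"
  shows "poly_mat (smult c f) M $$ (i, j) = c * poly_mat f M $$ (i, j)"
  using assms degree_smult_le[of c f]
  by (simp add: poly_mat_entry[where N = "degree f"] sum_distrib_left mult.assoc)

lemma poly_mat_minus_entry:
  assumes "M \<in> carrier_mat n n" "i < n" "j < n"
  shows "poly_mat (f - g) M $$ (i, j) = poly_mat f M $$ (i, j) - poly_mat g M $$ (i, j)"
  using poly_mat_add_entry[OF assms, of f "smult (- 1) g"] poly_mat_smult_entry[OF assms, of "- 1" g]
  by simp

lemma poly_mat_sum_entry:
  assumes "M \<in> carrier_mat n n" "i < n" "j < n"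
  shows "poly_mat (\<Sum>k\<in>K. f k) M $$ (i, j) = (\<Sum>k\<in>K. poly_mat (f k) M $$ (i, j))"
  by (induction K rule: infinite_finite_induct)
    (simp_all add: poly_mat_0_entry[OF assms] poly_mat_add_entry[OF assms])

lemma poly_mat_pCons_0_entry:
  assumes M: "M \<in> carrier_mat n n" and ij: "i < n" "j < n"
  shows "poly_mat (pCons 0 f) M $$ (i, j) = (\<Sum>m<n. poly_mat f M $$ (i, m) * M $$ (m, j))"
proof -
  have "poly_mat (pCons 0 f) M $$ (i, j)
      = (\<Sum>k\<le>Suc (degree f). coeff (pCons 0 f) k * (M ^\<^sub>m k) $$ (i, j))"
    using assms by (intro poly_mat_entry) (auto simp: degree_pCons_le)
  also have "\<dots> = (\<Sum>k\<le>degree f. coeff f k * (M ^\<^sub>m Suc k) $$ (i, j))"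
    by (subst sum.atMost_Suc_shift) simp
  also have "\<dots> = (\<Sum>k\<le>degree f. \<Sum>m<n. coeff f k * (M ^\<^sub>m k) $$ (i, m) * M $$ (m, j))"
  proof (intro sum.cong refl)
    fix k
    have "(M ^\<^sub>m Suc k) $$ (i, j) = (\<Sum>m<n. (M ^\<^sub>m k) $$ (i, m) * M $$ (m, j))"
      using M ij pow_carrier_mat[OF M, of k]
      by (auto simp: scalar_prod_def lessThan_atLeast0 intro!: sum.cong)
    then show "coeff f k * (M ^\<^sub>m Suc k) $$ (i, j)
        = (\<Sum>m<n. coeff f k * (M ^\<^sub>m k) $$ (i, m) * M $$ (m, j))"
      by (simp add: sum_distrib_left mult.assoc)
  qed
  also have "\<dots> = (\<Sum>m<n. \<Sum>k\<le>degree f. coeff f k * (M ^\<^sub>m k) $$ (i, m) * M $$ (m, j))"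
    by (rule sum.swap)
  also have "\<dots> = (\<Sum>m<n. poly_mat f M $$ (i, m) * M $$ (m, j))"
    using assms by (simp add: poly_mat_entry[where N = "degree f"] sum_distrib_right)
  finally show ?thesis .
qed

text \<open>Column \<open>j\<close> of the identity B adj(B) = det(B) I with B = X I - M, scaled by
  \<open>u\<close>, is a system of polynomial identities. Evaluating them at \<open>M\<close> and
  summing suitable entries telescopes, using only linearity and the rule for multiplication by X.
  The factor \<open>u\<close> covers all multiples of the characteristic polynomial.\<close>

lemma cayley_hamilton_entry:
  fixes M :: "'a::comm_ring_1 mat"
  assumes M: "M \<in> carrier_mat n n" and ij: "i < n" "j < n"
  shows "poly_mat (char_poly M * u) M $$ (i, j) = 0"
proof -
  define B where "B = char_poly_matrix M"
  define a where "a m = adj_mat B $$ (m, j) * u" for m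
  have B: "B \<in> carrier_mat n n"
    using M by (simp add: B_def)
  have entry: "B $$ (l, m) = (if l = m then [:0, 1:] else 0) + [:- (M $$ (l, m)):]"
    if "l < n" "m < n" for l m
    using that M by (simp add: B_def char_poly_matrix_def)
  have col: "(\<Sum>m<n. B $$ (l, m) * a m) = (if l = j then char_poly M * u else 0)" if l: "l < n" for l
  proof -
    have "(\<Sum>m<n. B $$ (l, m) * adj_mat B $$ (m, j)) = (B * adj_mat B) $$ (l, j)"
      using l ij B adj_mat(1)[OF B] by (simp add: scalar_prod_def lessThan_atLeast0)
    also have "\<dots> = (if l = j then char_poly M else 0)"
      using l ij adj_mat(2)[OF B] by (simp add: char_poly_def B_def)
    finally show ?thesis
      by (simp add: a_def sum_distrib_right[symmetric] mult.assoc[symmetric])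
  qed
  have split: "(\<Sum>m<n. B $$ (l, m) * a m) = pCons 0 (a l) - (\<Sum>m<n. smult (M $$ (l, m)) (a m))"
    if l: "l < n" for l
  proof -
    have "(\<Sum>m<n. B $$ (l, m) * a m)
        = (\<Sum>m<n. (if m = l then pCons 0 (a m) else 0) - smult (M $$ (l, m)) (a m))"
      using l by (intro sum.cong) (auto simp: entry algebra_simps)
    then show ?thesis
      using l by (simp add: sum_subtractf)
  qed
  \<comment> \<open>The \<open>l\<close>-th identity of the system contributes its entry
    \<open>(i, l)\<close>; only \<open>l = j\<close> has a nonzero left side.\<close>
  have "poly_mat (char_poly M * u) M $$ (i, j)
      = (\<Sum>l<n. if l = j then poly_mat (char_poly M * u) M $$ (i, l) else 0)"
    using ij by simp
  also have "\<dots> = (\<Sum>l<n. poly_mat (\<Sum>m<n. B $$ (l, m) * a m) M $$ (i, l))"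
    using M ij by (intro sum.cong) (auto simp: col poly_mat_0_entry)
  also have "\<dots> = (\<Sum>l<n. poly_mat (pCons 0 (a l)) M $$ (i, l)
      - (\<Sum>m<n. M $$ (l, m) * poly_mat (a m) M $$ (i, l)))"
    using M ij by (intro sum.cong refl)
      (simp add: split poly_mat_minus_entry poly_mat_sum_entry poly_mat_smult_entry)
  also have "\<dots> = (\<Sum>l<n. \<Sum>m<n. poly_mat (a l) M $$ (i, m) * M $$ (m, l))
      - (\<Sum>l<n. \<Sum>m<n. poly_mat (a m) M $$ (i, l) * M $$ (l, m))"
    using M ij by (simp add: sum_subtractf poly_mat_pCons_0_entry mult.commute)
  \<comment> \<open>The two double sums coincide once the roles of \<open>l\<close> and
    \<open>m\<close> are exchanged.\<close>
  also have "\<dots> = 0"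
    by (subst sum.swap) simp
  finally show ?thesis .
qed

lemma poly_mat_of_int_entry:
  assumes M: "M \<in> carrier_mat n n" and ij: "i < n" "j < n"
  shows "poly_mat (of_int_poly g :: 'a::{comm_ring_1,ring_char_0} poly) (map_mat of_int M) $$ (i, j)
    = of_int (poly_mat g M $$ (i, j))"
  using M ij pow_carrier_mat[OF M]
  by (simp add: poly_mat_entry[where N = "degree g"] poly_mat_entry[where n = n and N = "degree g" and M = "map_mat of_int M"]
      of_int_hom.mat_hom_pow[OF M, symmetric])

lemma poly_mat_eigenrelation:
  fixes w :: "nat \<Rightarrow> 'b::field_char_0" and M :: "rat mat"
  assumes M: "M \<in> carrier_mat n n"
    and eq: "\<And>i. i < n \<Longrightarrow> y * w i = (\<Sum>j<n. of_rat (M $$ (i, j)) * w j)" and i: "i < n"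
  shows "poly (map_poly of_rat f) y * w i = (\<Sum>j<n. of_rat (poly_mat f M $$ (i, j)) * w j)"
proof -
  have "poly (map_poly of_rat f) y * w i
      = (\<Sum>k\<le>degree f. of_rat (coeff f k) * (y ^ k * w i))"
    by (simp add: poly_altdef sum_distrib_right mult.assoc)
  also have "\<dots> = (\<Sum>k\<le>degree f. of_rat (coeff f k) * (\<Sum>j<n. of_rat ((M ^\<^sub>m k) $$ (i, j)) * w j))"
    using matrix_power_eigenrelation[OF of_rat_hom.comm_ring_hom_axioms M eq i] by simp
  also have "\<dots> = (\<Sum>j<n. \<Sum>k\<le>degree f. of_rat (coeff f k) * (of_rat ((M ^\<^sub>m k) $$ (i, j)) * w j))"
    by (simp add: sum_distrib_left) (rule sum.swap)
  also have "\<dots> = (\<Sum>j<n. of_rat (poly_mat f M $$ (i, j)) * w j)"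
    using M i
    by (intro sum.cong refl)
      (simp add: poly_mat_entry[where N = "degree f"] of_rat_sum of_rat_mult sum_distrib_right mult.assoc)
  finally show ?thesis .
qed

section \<open>From integrality over \<open>Int_mats\<close> to algebraic integer values\<close>

lemma of_rat_poly_of_int_poly [simp]:
  "map_poly of_rat (of_int_poly p) = (of_int_poly p :: 'a::field_char_0 poly)"
  by (simp add: map_poly_map_poly o_def)

lemma of_int_poly_dvd_of_common_root:
  fixes x :: "'a::field_char_0"
  assumes p: "lead_coeff p = 1" "irreducible p" "degree p > 0" "poly (of_int_poly p) x = 0"
    and u: "poly (map_poly of_rat u) x = 0"
  shows "of_int_poly p dvd u"
proof (rule irreducible_dvd_of_common_root)
  show "irreducible (of_int_poly p :: rat poly)"
    using p by (intro irreducible_of_int_poly)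
qed (use p u in simp_all)

text \<open>No determinant is expanded: the characteristic polynomial vanishes at a root of
  \<open>p\<close>, so it is divisible by the irreducible \<open>p\<close>, and both are monic of
  the same degree.\<close>

lemma char_poly_companion:
  fixes p :: "int poly"
  assumes p: "lead_coeff p = 1" "irreducible p" "degree p > 0"
  shows "char_poly (companion p) = p"
proof -
  obtain x :: "rat alg_closure" where x: "poly (of_int_poly p) x = 0"
    using p(3) alg_closed_imp_poly_has_root[of "of_int_poly p :: rat alg_closure poly"] by auto
  let ?c = "char_poly (companion p)"
  have "poly (of_int_poly ?c) x = 0"
    using char_poly_root_of_eigenrelation[OF of_int_hom.comm_ring_hom_axioms companion_carrier p(3),
        of "\<lambda>i. x ^ i" x]
      companion_eigenrelation[OF of_int_hom.comm_ring_hom_axioms p(1) x]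
    by simp
  then obtain r :: "rat poly" where r: "of_int_poly ?c = of_int_poly p * r"
    using of_int_poly_dvd_of_common_root[OF p x, of "of_int_poly ?c"] by auto
  have c: "degree ?c = degree p" "lead_coeff ?c = 1"
    using degree_monic_char_poly[OF companion_carrier, of p] by auto
  have "(of_int_poly ?c :: rat poly) \<noteq> 0" "(of_int_poly p :: rat poly) \<noteq> 0"
    using c p by auto
  then have "degree r = 0"
    using r c(1) by (metis add_cancel_left_right degree_mult_eq mult_zero_right of_int_hom.degree_map_poly_hom)
  then obtain b where b: "r = [:b:]"
    by (metis degree_eq_zeroE)
  have "lead_coeff (of_int_poly ?c :: rat poly) = lead_coeff (of_int_poly p) * b"
    by (simp add: r b)
  then have "b = 1"
    using p(1) c by simp
  then show ?thesis
    using r b by simp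
qed

lemma Int_mats_iff:
  "f \<in> Int_mats n P \<longleftrightarrow>
    (\<forall>M \<in> int_mats_charpoly n P. \<forall>i<n. \<forall>j<n. poly_mat f (map_mat of_int M) $$ (i, j) \<in> \<int>)"
proof -
  have "poly_mat f (map_mat of_int M) \<in> int_mats_in_rat n \<longleftrightarrow>
      (\<forall>i<n. \<forall>j<n. poly_mat f (map_mat of_int M) $$ (i, j) \<in> \<int>)" (is "?l \<longleftrightarrow> ?r")
    if "M \<in> int_mats_charpoly n P" for M
  proof
    assume ?l
    then show ?r
      by (auto simp: int_mats_in_rat_def)
  next
    assume r: ?r
    have M: "dim_row M = n"
      using that by (auto simp: int_mats_charpoly_def)
    let ?A = "poly_mat f (map_mat of_int M)"
    \<comment> \<open>Taking floors fixes integral entries and so produces the integer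
      preimage.\<close>
    have "?A = map_mat of_int (map_mat floor ?A)"
      using r M by (intro eq_matI) (auto simp: poly_mat_def)
    moreover have "map_mat floor ?A \<in> carrier_mat n n"
      using M by (simp add: poly_mat_def)
    ultimately show ?l
      unfolding int_mats_in_rat_def by blast
  qed
  then show ?thesis
    by (auto simp: Int_mats_def)
qed

text \<open>This expresses multiplication by f(x) on the powers of x through the rational matrix
  f(C), \<open>C\<close> being the companion matrix; it serves both the degree bound and
  integrality.\<close>

lemma companion_eigenrelation_rat:
  fixes x :: "'b::field_char_0"
  assumes p: "lead_coeff p = 1" "poly (of_int_poly p) x = 0" and i: "i < degree p"
  shows "poly (map_poly of_rat f) x * x ^ i
    = (\<Sum>j<degree p. of_rat (poly_mat f (map_mat of_int (companion p)) $$ (i, j)) * x ^ j)"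
proof (rule poly_mat_eigenrelation[OF _ _ i])
  fix i assume i: "i < degree p"
  show "x * x ^ i = (\<Sum>j<degree p. of_rat (map_mat of_int (companion p) $$ (i, j)) * x ^ j)"
    using companion_eigenrelation[OF of_int_hom.comm_ring_hom_axioms p i]
      carrier_matD[OF companion_carrier, of p] i by simp
qed simp

text \<open>The value f(x) is an eigenvalue of f(C), hence a root of a monic rational polynomial of
  degree \<open>degree p\<close>.\<close>

lemma degree_min_poly_rat_value_le:
  assumes p: "lead_coeff p = 1" "degree p > 0" "poly (of_int_poly p) x = 0"
  shows "degree (min_poly_rat (poly (map_poly of_rat f) x)) \<le> degree p"
proof -
  let ?A = "poly_mat f (map_mat of_int (companion p))"
  have A: "?A \<in> carrier_mat (degree p) (degree p)"
    using carrier_matD[OF companion_carrier, of p] by (simp add: poly_mat_def)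
  have c: "degree (char_poly ?A) = degree p" "lead_coeff (char_poly ?A) = 1"
    using degree_monic_char_poly[OF A] by auto
  then have "char_poly ?A \<noteq> 0"
    using p(2) by auto
  moreover have "poly (map_poly of_rat (char_poly ?A)) (poly (map_poly of_rat f) x) = 0"
    using char_poly_root_of_eigenrelation[OF of_rat_hom.comm_ring_hom_axioms A p(2), of "\<lambda>i. x ^ i"]
      companion_eigenrelation_rat[OF p(1,3)] by simp
  ultimately show ?thesis
    using c min_poly_rat(4) dvd_imp_degree_le by metis
qed

text \<open>Determinant trick over the integers for the products y^k x^i with \<open>k < m\<close>
  and \<open>i < n\<close>, where y = f(x): the relation for \<open>f\<close> reduces y^m, and the
  coefficients a_k(x) act on the powers of x by integer matrices.\<close>

lemma algebraic_int_value_of_integral: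
  fixes f :: "rat poly" and x :: "rat alg_closure"
  assumes p: "p \<in> P" "lead_coeff p = 1" "irreducible p" "degree p = n" "n > 0"
      "poly (of_int_poly p) x = 0"
    and a: "\<And>k. k < m \<Longrightarrow> a k \<in> Int_mats n P"
    and rel: "f ^ m + (\<Sum>k<m. a k * f ^ k) = 0"
  shows "algebraic_int (poly (map_poly of_rat f) x)"
proof -
  define y where "y = poly (map_poly of_rat f) x"
  \<comment> \<open>For \<open>m = 0\<close> the relation would read 1 = 0.\<close>
  have "m > 0"
    using rel by (cases m) auto
  have C: "companion p \<in> int_mats_charpoly n P"
    using p companion_carrier[of p] char_poly_companion[of p] by (simp add: int_mats_charpoly_def)
  define N where "N k i j = \<lfloor>poly_mat (a k) (map_mat of_int (companion p)) $$ (i, j)\<rfloor>" for k i j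
  have N: "of_int (N k i j) = poly_mat (a k) (map_mat of_int (companion p)) $$ (i, j)"
    if "k < m" "i < n" "j < n" for k i j
    using a[OF that(1)] C that unfolding Int_mats_iff N_def by simp
  have ax: "poly (map_poly of_rat (a k)) x * x ^ i = (\<Sum>j<n. of_int (N k i j) * x ^ j)"
    if "k < m" "i < n" for k i
  proof -
    have "poly (map_poly of_rat (a k)) x * x ^ i
        = (\<Sum>j<n. of_rat (poly_mat (a k) (map_mat of_int (companion p)) $$ (i, j)) * x ^ j)"
      using companion_eigenrelation_rat[OF p(2,6)] that p(4) by simp
    also have "\<dots> = (\<Sum>j<n. of_rat (of_int (N k i j)) * x ^ j)"
      using that by (intro sum.cong) (simp_all add: N)
    finally show ?thesis
      by simp
  qed
  have "poly (map_poly of_rat (f ^ m + (\<Sum>k<m. a k * f ^ k))) x = 0"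
    by (simp add: rel)
  then have "y ^ m + (\<Sum>k<m. poly (map_poly of_rat (a k)) x * y ^ k) = 0"
    by (simp add: y_def hom_distribs poly_sum)
  then have ym: "y ^ m = - (\<Sum>k<m. poly (map_poly of_rat (a k)) x * y ^ k)"
    by (simp add: eq_neg_iff_add_eq_0)
  define w where "w = (\<lambda>(k, i). y ^ k * x ^ i)"
  \<comment> \<open>A block companion matrix: multiplication by \<open>y\<close> raises
    \<open>k\<close> by one, and in the last block the relation for \<open>y ^ m\<close> supplies
    the negated matrices \<open>N l\<close>.\<close>
  define A :: "nat \<times> nat \<Rightarrow> nat \<times> nat \<Rightarrow> int" where
    "A = (\<lambda>(k, i) (l, j). if Suc k < m then (if (l, j) = (Suc k, i) then 1 else 0) else - N l i j)"
  have rel: "y * w ki = (\<Sum>lj\<in>{..<m} \<times> {..<n}. of_int (A ki lj) * w lj)"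
    if ki_in: "ki \<in> {..<m} \<times> {..<n}" for ki
  proof -
    obtain k i where ki: "ki = (k, i)" "k < m" "i < n"
      using ki_in by auto
    show ?thesis
    proof (cases "Suc k < m")
      case True
      have "(\<Sum>lj\<in>{..<m} \<times> {..<n}. of_int (A ki lj) * w lj)
          = (\<Sum>lj\<in>{..<m} \<times> {..<n}. if lj = (Suc k, i) then w lj else 0)"
        using True by (intro sum.cong) (auto simp: A_def ki split: if_splits)
      also have "\<dots> = w (Suc k, i)"
        using True ki by simp
      finally show ?thesis
        by (simp add: w_def ki)
    next
      case False
      \<comment> \<open>Here \<open>k\<close> is the last index, so
        \<open>Suc k = m\<close>.\<close>
      then have "y * w ki = y ^ m * x ^ i"
        using ki by (metis (no_types, lifting) Suc_lessI case_prod_conv mult.assoc power_Suc w_def)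
      also have "\<dots> = - (\<Sum>l<m. y ^ l * (poly (map_poly of_rat (a l)) x * x ^ i))"
        by (simp add: ym sum_distrib_left sum_distrib_right algebra_simps)
      also have "\<dots> = - (\<Sum>l<m. y ^ l * (\<Sum>j<n. of_int (N l i j) * x ^ j))"
        using ki by (simp add: ax)
      also have "\<dots> = (\<Sum>l<m. \<Sum>j<n. of_int (A ki (l, j)) * w (l, j))"
        using False by (simp add: A_def w_def ki sum_distrib_left sum_negf algebra_simps)
      also have "\<dots> = (\<Sum>lj\<in>{..<m} \<times> {..<n}. of_int (A ki lj) * w lj)"
        by (simp add: sum.cartesian_product split_def)
      finally show ?thesis .
    qed
  qed
  show ?thesis
    unfolding y_def[symmetric]
  proof (rule monic_root_of_stable_span[OF of_int_hom.comm_ring_hom_axioms _ _ _ rel])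
    show "(0, 0) \<in> {..<m} \<times> {..<n}" "w (0, 0) \<noteq> 0"
      using \<open>m > 0\<close> p(5) by (auto simp: w_def)
    fix q :: "int poly" assume "lead_coeff q = 1" "poly (of_int_poly q) y = 0"
    then show "algebraic_int y"
      unfolding algebraic_int_altdef_ipoly by blast
  qed simp
qed

section \<open>Integral closedness of a domain with gcds\<close>

text \<open>Rational root theorem: for x = a/b in lowest terms, clearing denominators in the monic
  equation shows that \<open>b\<close> divides a power of \<open>a\<close>, so \<open>b\<close> is a
  unit. The normalized choice of \<open>b\<close> turns the unit into 1.\<close>

lemma fract_root_of_monic:
  fixes q :: "'a::{ring_gcd,semiring_gcd_mult_normalize,idom_divide} fract poly"
  assumes q: "lead_coeff q = 1" "\<And>i. coeff q i \<in> range to_fract" "poly q x = 0"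
  shows "x \<in> range to_fract"
proof -
  define a b where "a = fst (quot_of_fract x)" and "b = snd (quot_of_fract x)"
  have b: "b \<noteq> 0" "Rings.coprime a b" "normalize b = b"
    by (simp_all add: a_def b_def coprime_quot_of_fract normalize_snd_quot_of_fract)
  have "x = Fract a b"
    unfolding a_def b_def by (rule Fract_quot_of_fract[symmetric])
  then have x: "x * to_fract b = to_fract a"
    using b(1) by (simp add: Fract_conv_to_fract)
  define m where "m = degree q"
  have pow: "to_fract (u ^ k) = to_fract u ^ k" for u :: 'a and k
    by (induction k) simp_all
  have "\<forall>i. \<exists>c. coeff q i = to_fract c"
    using q(2) by blast
  then obtain c where c: "\<And>i. coeff q i = to_fract (c i)"
    by metis
  have "0 = to_fract b ^ m * (\<Sum>i\<le>m. coeff q i * x ^ i)"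
    using q(3) by (simp add: poly_altdef m_def)
  also have "\<dots> = (\<Sum>i\<le>m. coeff q i * to_fract a ^ i * to_fract b ^ (m - i))"
    unfolding sum_distrib_left
  proof (intro sum.cong refl)
    fix i assume "i \<in> {..m}"
    then have "to_fract b ^ m = to_fract b ^ i * to_fract b ^ (m - i)"
      by (simp flip: power_add)
    then show "to_fract b ^ m * (coeff q i * x ^ i) = coeff q i * to_fract a ^ i * to_fract b ^ (m - i)"
      by (simp add: x[symmetric] power_mult_distrib algebra_simps)
  qed
  also have "\<dots> = to_fract (\<Sum>i\<le>m. c i * a ^ i * b ^ (m - i))"
    by (simp add: c pow)
  finally have "(\<Sum>i\<le>m. c i * a ^ i * b ^ (m - i)) = 0"
    by (metis to_fract_eq_0_iff)
  moreover have "c m = 1"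
    using q(1) c[of m] by (simp add: m_def flip: to_fract_1)
  ultimately have "a ^ m = - (\<Sum>i<m. c i * a ^ i * b ^ (m - i))"
    by (simp add: lessThan_Suc_atMost[symmetric] eq_neg_iff_add_eq_0 add.commute)
  \<comment> \<open>Every exponent \<open>m - i\<close> is positive since
    \<open>i < m\<close>.\<close>
  moreover have "b dvd (\<Sum>i<m. c i * a ^ i * b ^ (m - i))"
    by (intro dvd_sum dvd_mult) (auto intro!: dvd_power)
  ultimately have "b dvd a ^ m"
    by simp
  moreover have "Rings.coprime (a ^ m) b"
    using b(2) by simp
  ultimately have "is_unit b"
    by (meson coprime_common_divisor dvd_refl)
  then have "b = 1"
    using b(3) is_unit_normalize by metis
  then show ?thesis
    using x by auto
qed

section \<open>Bounded denominators and a uniform monic polynomial\<close>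

text \<open>In Horner form each multiplication by \<open>f\<close> costs one factor
  \<open>d\<close>, and at most \<open>n\<close> of them occur.\<close>

lemma smult_power_pcompose_integral:
  fixes f :: "rat poly" and r :: "int poly"
  assumes f: "smult (of_int d) f = of_int_poly g" and r: "degree r \<le> n"
  shows "\<exists>G. smult (of_int d ^ n) (pcompose (of_int_poly r) f) = of_int_poly G"
  using r
proof (induction n arbitrary: r)
  case 0
  then obtain c where "r = [:c:]"
    by (metis degree_eq_zeroE le_zero_eq)
  then show ?case
    by (intro exI[of _ r]) (simp add: of_int_hom.map_poly_pCons_hom)
next
  case (Suc n)
  obtain c s where r: "r = pCons c s"
    by (cases r)
  have "degree s \<le> n"
    using Suc.prems by (cases "s = 0") (auto simp: r)
  then obtain G where G: "smult (of_int d ^ n) (pcompose (of_int_poly s) f) = of_int_poly G"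
    using Suc.IH by blast
  define e :: rat where "e = of_int d ^ n"
  have "smult (of_int d ^ Suc n) (pcompose (of_int_poly r) f)
      = [:of_int d * e * of_int c:] + smult (of_int d) f * smult e (pcompose (of_int_poly s) f)"
    by (simp add: r of_int_hom.map_poly_pCons_hom pcompose_pCons smult_add_right e_def[symmetric] mult.commute)
  also have "\<dots> = of_int_poly ([:d ^ Suc n * c:] + g * G)"
    unfolding f G[folded e_def] of_int_poly_hom.hom_add of_int_poly_hom.hom_mult
    by (simp add: of_int_hom.map_poly_pCons_hom e_def)
  finally show ?case
    by blast
qed

text \<open>Pseudo-division by a monic polynomial is true division. The weak degree bound also
  covers constant \<open>h\<close> with remainder 0.\<close>

lemma monic_division:
  fixes h s :: "int poly"
  assumes "lead_coeff h = 1"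
  obtains q r where "s = h * q + r" "degree r \<le> degree h"
proof -
  have h: "h \<noteq> 0"
    using assms by auto
  obtain q r where qr: "pseudo_divmod s h = (q, r)"
    by fastforce
  have "s = h * q + r"
    using pseudo_divmod(1)[OF h qr] assms by simp
  moreover have "degree r \<le> degree h"
    using pseudo_divmod(2)[OF h qr] by auto
  ultimately show ?thesis
    using that by blast
qed

text \<open>The powers of \<open>f(M)\<close> have bounded denominators because \<open>h(f(M)) = 0\<close>; so it is enough
  that \<open>\<phi>\<close> is divisible by \<open>h\<close> modulo the common denominator.\<close>

lemma poly_mat_pcompose_integral:
  fixes f :: "rat poly" and M :: "int mat"
  assumes M: "M \<in> carrier_mat n n" and ij: "i < n" "j < n"
    and f: "smult (of_int d) f = of_int_poly g"
    and h: "lead_coeff h = 1" "degree h \<le> n" "of_int_poly (char_poly M) dvd pcompose (of_int_poly h) f"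
    and \<phi>: "h = b + smult (2 * d ^ n) s" "\<phi> = b * t"
  shows "poly_mat (pcompose (of_int_poly \<phi>) f) (map_mat of_int M) $$ (i, j) \<in> \<int>"
proof -
  let ?M = "map_mat of_int M :: rat mat"
  have M': "?M \<in> carrier_mat n n"
    using M by simp
  obtain q r where qr: "s * t = h * q + r" "degree r \<le> n"
    using monic_division[OF h(1), of "s * t"] h(2) by (metis le_trans)
  obtain G where G: "smult (of_int d ^ n) (pcompose (of_int_poly r) f) = of_int_poly G"
    using smult_power_pcompose_integral[OF f qr(2)] by blast
  obtain u where u: "pcompose (of_int_poly h) f = of_int_poly (char_poly M) * u"
    using h(3) by blast
  \<comment> \<open>Substituting b = h - 2 d^n s and s t = h q + r into b t gives h v - 2 d^n r: the
    first term dies at \<open>M\<close> by Cayley-Hamilton, and the second is integral after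
    composing with \<open>f\<close>.\<close>
  define v where "v = t - smult (2 * d ^ n) q"
  have "\<phi> = (h - smult (2 * d ^ n) s) * t"
    using \<phi> by simp
  also have "\<dots> = h * t - smult (2 * d ^ n) (s * t)"
    by (simp add: left_diff_distrib)
  also have "\<dots> = h * v - smult (2 * d ^ n) r"
    by (simp add: qr(1) v_def algebra_simps smult_add_right)
  finally have "pcompose (of_int_poly \<phi>) f
      = pcompose (of_int_poly h) f * pcompose (of_int_poly v) f
        - smult 2 (smult (of_int d ^ n) (pcompose (of_int_poly r) f))"
    by (simp add: hom_distribs pcompose_diff pcompose_mult pcompose_smult)
  also have "\<dots> = char_poly ?M * (u * pcompose (of_int_poly v) f) - smult 2 (of_int_poly G)"
    by (simp add: u G of_int_hom.char_poly_hom[OF M] mult.assoc)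
  finally show ?thesis
    using ij
    by (simp add: poly_mat_minus_entry[OF M'] poly_mat_smult_entry[OF M'] cayley_hamilton_entry[OF M']
        poly_mat_of_int_entry[OF M])
qed

lemma finite_bounded_int_polys:
  "finite {h :: int poly. degree h \<le> n \<and> set (coeffs h) \<subseteq> {0..D}}"
proof (rule finite_subset)
  let ?L = "{xs :: int list. set xs \<subseteq> {0..D} \<and> length xs \<le> Suc n}"
  show "{h :: int poly. degree h \<le> n \<and> set (coeffs h) \<subseteq> {0..D}} \<subseteq> Poly ` ?L"
  proof
    fix h :: "int poly"
    assume "h \<in> {h. degree h \<le> n \<and> set (coeffs h) \<subseteq> {0..D}}"
    then have "coeffs h \<in> ?L"
      by (cases "h = 0") (auto simp: length_coeffs)
    then show "h \<in> Poly ` ?L"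
      by (intro image_eqI[of h Poly "coeffs h"]) simp_all
  qed
  show "finite (Poly ` ?L)"
    by (intro finite_imageI finite_lists_length_le) simp
qed

text \<open>Coefficients are reduced modulo \<open>D\<close>; as \<open>D > 1\<close>, the leading 1
  is its own residue, so degree and monicity survive.\<close>

lemma monic_residue:
  fixes h :: "int poly"
  assumes h: "lead_coeff h = 1" and D: "D > 1"
  obtains b s where "h = b + smult D s" "lead_coeff b = 1" "degree b = degree h"
    "set (coeffs b) \<subseteq> {0..D}"
proof
  let ?b = "map_poly (\<lambda>c. c mod D) h" and ?s = "map_poly (\<lambda>c. c div D) h"
  show "h = ?b + smult D ?s"
    by (intro poly_eqI) (simp add: coeff_map_poly)
  show deg: "degree ?b = degree h"
    using h D by (intro degree_map_poly) auto
  show "lead_coeff ?b = 1"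
    using h D unfolding deg by (simp add: coeff_map_poly)
  have "coeff ?b i \<in> {0..D}" for i
    using D pos_mod_bound[of D "coeff h i", THEN less_imp_le] pos_mod_sign[of D "coeff h i"]
    by (simp add: coeff_map_poly)
  then have "insert 0 (set (coeffs ?b)) \<subseteq> {0..D}"
    unfolding range_coeff[symmetric] by blast
  then show "set (coeffs ?b) \<subseteq> {0..D}"
    by blast
qed

lemma Int_rat_imp_monic_pcompose:
  assumes n: "n > 0"
    and P: "\<And>p. p \<in> P \<Longrightarrow> lead_coeff p = 1 \<and> irreducible p \<and> degree p = n"
    and f: "f \<in> Int_rat (roots_of_set P) (alg_ints_deg_le n)"
  obtains \<phi> :: "int poly" where "lead_coeff \<phi> = 1" "degree \<phi> > 0"
    "pcompose (of_int_poly \<phi>) f \<in> Int_mats n P"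
proof -
  obtain d g where dg: "rat_to_int_poly f = (d, g)"
    by fastforce
  have d: "smult (of_int d) f = of_int_poly g" "d > 0"
    using rat_to_int_poly[OF dg] by simp_all
  define D where "D = 2 * d ^ n"
  have D: "D > 1"
    using d(2) zero_less_power[of d n] unfolding D_def by linarith
  \<comment> \<open>This finite set contains a monic representative modulo \<open>D\<close> of every
    minimal polynomial that can occur, whatever the matrix.\<close>
  define H where "H = {h :: int poly. lead_coeff h = 1 \<and> degree h \<le> n \<and> set (coeffs h) \<subseteq> {0..D}}"
  have H: "finite H"
    by (rule finite_subset[OF _ finite_bounded_int_polys[of n D]]) (auto simp: H_def)
  \<comment> \<open>The factor \<open>[:0, 1:]\<close> makes positivity of the degree
    immediate.\<close>
  define \<phi> where "\<phi> = [:0, 1:] * \<Prod>H"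
  have lH: "lead_coeff (\<Prod>H) = 1"
    by (subst lead_coeff_prod) (simp add: H_def)
  then have "lead_coeff \<phi> = 1"
    unfolding \<phi>_def by (subst lead_coeff_mult) simp
  moreover have "\<Prod>H \<noteq> 0"
    using lH by auto
  then have "degree \<phi> > 0"
    unfolding \<phi>_def by (subst degree_mult_eq) auto
  moreover have "pcompose (of_int_poly \<phi>) f \<in> Int_mats n P"
    unfolding Int_mats_iff
  proof (intro ballI allI impI)
    fix M i j assume M: "M \<in> int_mats_charpoly n P" and ij: "i < n" "j < n"
    define p where "p = char_poly M"
    have p: "p \<in> P" "lead_coeff p = 1" "irreducible p" "degree p = n" and M': "M \<in> carrier_mat n n"
      using M P[of p] by (auto simp: int_mats_charpoly_def p_def)
    obtain x :: "rat alg_closure" where x: "poly (of_int_poly p) x = 0"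
      using p(4) n alg_closed_imp_poly_has_root[of "of_int_poly p :: rat alg_closure poly"] by auto
    define y where "y = poly (map_poly of_rat f) x"
    have y: "algebraic_int y" "degree (min_poly_rat y) \<le> n"
      using f p(1) x by (auto simp: Int_rat_def roots_of_set_def alg_ints_deg_le_def y_def)
    obtain h :: "int poly" where h: "lead_coeff h = 1" "min_poly_rat y = of_int_poly h"
      using min_poly_rat_algebraic_int[OF y(1)] by blast
    have deg_h: "degree h \<le> n"
      using y(2) h(2) by simp
    obtain k :: "int poly" where k: "poly (of_int_poly k) y = 0" "lead_coeff k = 1"
      using y(1) by (auto simp: algebraic_int_altdef_ipoly)
    then have "(of_int_poly k :: rat poly) \<noteq> 0"
      by auto
    then have "poly (map_poly of_rat (min_poly_rat y)) y = 0"
      using k by (intro min_poly_rat(3)[of "of_int_poly k"]) simp_all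
    then have hy: "poly (of_int_poly h) y = 0"
      by (simp add: h(2))
    \<comment> \<open>The composite vanishes at \<open>x\<close> because h(f(x)) = h(y) = 0, and
      \<open>p\<close> is irreducible with root \<open>x\<close>.\<close>
    have dvd: "of_int_poly p dvd pcompose (of_int_poly h) f"
      using p x n hy
      by (intro of_int_poly_dvd_of_common_root[of p x])
        (auto simp: of_rat_hom.map_poly_pcompose poly_pcompose y_def)
    obtain b s where b: "h = b + smult D s" "lead_coeff b = 1" "degree b = degree h"
        "set (coeffs b) \<subseteq> {0..D}"
      using monic_residue[OF h(1) D] by blast
    have "b \<in> H"
      using b deg_h by (simp add: H_def)
    then have "b dvd \<phi>"
      unfolding \<phi>_def using H by (intro dvd_mult dvd_prodI)
    then obtain t where t: "\<phi> = b * t"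
      by blast
    show "poly_mat (pcompose (of_int_poly \<phi>) f) (map_mat of_int M) $$ (i, j) \<in> \<int>"
      using poly_mat_pcompose_integral[OF M' ij d(1) h(1) deg_h _ _ t] dvd b(1)
      by (simp add: p_def D_def)
  qed
  ultimately show ?thesis
    using that by blast
qed

section \<open>Monic equations over \<open>Int_mats\<close> and the two inclusions\<close>

lemma Int_mats_of_int_const: "[:of_int c:] \<in> Int_mats n P"
  unfolding Int_mats_iff
proof (intro ballI allI impI)
  fix M i j assume "M \<in> int_mats_charpoly n P" and ij: "i < n" "j < n"
  then have M: "M \<in> carrier_mat n n"
    by (simp add: int_mats_charpoly_def)
  then show "poly_mat [:of_int c:] (map_mat of_int M) $$ (i, j) \<in> (\<int> :: rat set)"
    using poly_mat_of_int_entry[OF M ij, of "[:c:]", where 'a = rat]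
    by (simp add: of_int_hom.map_poly_pCons_hom)
qed

lemma Int_mats_diff:
  assumes "f \<in> Int_mats n P" "g \<in> Int_mats n P"
  shows "f - g \<in> Int_mats n P"
  unfolding Int_mats_iff
proof (intro ballI allI impI)
  fix M i j assume M: "M \<in> int_mats_charpoly n P" and ij: "i < n" "j < n"
  then have "map_mat of_int M \<in> carrier_mat n n"
    by (simp add: int_mats_charpoly_def)
  then show "poly_mat (f - g) (map_mat of_int M) $$ (i, j) \<in> \<int>"
    using assms M ij by (simp add: poly_mat_minus_entry Int_mats_iff)
qed

text \<open>With \<open>F\<close> the composite of \<open>\<phi>\<close> and \<open>f\<close>, the
  element \<open>f\<close> is a root of \<phi>(T) - F. Its coefficients are integer constants,
  except that \<open>F\<close> is subtracted from the constant one.\<close>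

lemma to_fract_integral_of_pcompose:
  assumes \<phi>: "lead_coeff \<phi> = 1" "degree \<phi> > 0" "pcompose (of_int_poly \<phi>) f \<in> Int_mats n P"
  shows "to_fract f \<in> integral_closure (to_fract ` Int_mats n P)"
proof -
  define F where "F = pcompose (of_int_poly \<phi>) f"
  define c :: "int \<Rightarrow> rat poly fract" where "c = (\<lambda>k. to_fract [:of_int k:])"
  define Q where "Q = map_poly c \<phi>"
  have c0: "c 0 = 0" "c 1 = 1"
    by (simp_all add: c_def flip: one_pCons)
  have "poly (map_poly c u) (to_fract f) = to_fract (pcompose (of_int_poly u) f)"
    for u :: "int poly"
  proof (induction u)
    case (pCons k u)
    then show ?case
      by (simp add: map_poly_pCons c0 c_def of_int_hom.map_poly_pCons_hom pcompose_pCons)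
  qed simp
  then have QF: "poly Q (to_fract f) = to_fract F"
    by (simp add: Q_def F_def)
  have cQ: "coeff Q i = to_fract [:of_int (coeff \<phi> i):]" for i
    by (simp add: Q_def coeff_map_poly c0) (simp add: c_def)
  have degQ: "degree Q = degree \<phi>"
    unfolding Q_def using \<phi>(1) by (intro degree_map_poly) (auto simp: c0)
  have coeff: "coeff (Q - [:to_fract F:]) i = to_fract ([:of_int (coeff \<phi> i):] - (if i = 0 then F else 0))" for i
    by (cases i) (simp_all add: cQ)
  show ?thesis
    unfolding integral_closure_def
  proof (intro CollectI exI[of _ "Q - [:to_fract F:]"] conjI allI)
    \<comment> \<open>Since \<open>\<phi>\<close> has positive degree, subtracting a constant leaves
      the leading term untouched.\<close>
    have "degree (Q - [:to_fract F:]) = degree Q"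
      using degQ \<phi>(2) degree_add_eq_left[of "- [:to_fract F:]" Q]
      by (simp del: add_uminus_conv_diff add: diff_conv_add_uminus)
    then show "lead_coeff (Q - [:to_fract F:]) = 1"
      unfolding coeff using \<phi>(1,2) degQ by (simp flip: one_pCons)
    show "coeff (Q - [:to_fract F:]) i \<in> to_fract ` Int_mats n P" for i
    proof -
      have "F \<in> Int_mats n P"
        using \<phi>(3) by (simp add: F_def)
      then have "[:of_int (coeff \<phi> i):] - (if i = 0 then F else 0) \<in> Int_mats n P"
        using Int_mats_of_int_const Int_mats_diff by simp
      then show ?thesis
        unfolding coeff by blast
    qed
    show "poly (Q - [:to_fract F:]) (to_fract f) = 0"
      by (simp add: QF)
  qed
qed

theorem mainTheorem6:
  fixes n :: nat and P :: "int poly set"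
  assumes "n > 0"
    and "\<And>p. p \<in> P \<Longrightarrow> lead_coeff p = 1 \<and> irreducible p \<and> degree p = n"
  shows "integral_closure (to_fract ` Int_mats n P) =
    to_fract ` Int_rat (roots_of_set P) (alg_ints_deg_le n)"
proof (intro equalityI subsetI)
  fix z assume "z \<in> integral_closure (to_fract ` Int_mats n P)"
  then obtain q where q: "lead_coeff q = 1" "\<And>i. coeff q i \<in> to_fract ` Int_mats n P" "poly q z = 0"
    by (auto simp: integral_closure_def)
  \<comment> \<open>The coefficients lie in the image of the rational polynomials, which are
    integrally closed in their fraction field, so \<open>z\<close> is itself a polynomial.\<close>
  then obtain f where z: "z = to_fract f"
    using fract_root_of_monic[of q z] by blast
  obtain a where a: "\<And>i. a i \<in> Int_mats n P" "\<And>i. coeff q i = to_fract (a i)"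
    using q(2) unfolding image_iff by metis
  have pow: "to_fract f ^ k = to_fract (f ^ k)" for k
    by (induction k) simp_all
  \<comment> \<open>Injectivity of \<open>to_fract\<close> brings the monic equation back to
    polynomials, where it can be evaluated at roots of elements of \<open>P\<close>.\<close>
  have "to_fract (f ^ degree q + (\<Sum>k<degree q. a k * f ^ k)) = (\<Sum>k\<le>degree q. coeff q k * z ^ k)"
    using q(1) by (simp add: lessThan_Suc_atMost[symmetric] z a(2) pow)
  also have "\<dots> = 0"
    using q(3) by (simp add: poly_altdef)
  finally have rel: "f ^ degree q + (\<Sum>k<degree q. a k * f ^ k) = 0"
    by (metis to_fract_eq_0_iff)
  have "f \<in> Int_rat (roots_of_set P) (alg_ints_deg_le n)"
    unfolding Int_rat_def alg_ints_deg_le_def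
  proof (intro CollectI ballI conjI)
    fix x assume "x \<in> roots_of_set P"
    then obtain p where p: "p \<in> P" "poly (of_int_poly p) x = 0"
      by (auto simp: roots_of_set_def)
    show "algebraic_int (poly (map_poly of_rat f) x)"
      using algebraic_int_value_of_integral[OF p(1) _ _ _ assms(1) p(2) a(1) rel] assms(2)[OF p(1)]
      by blast
    show "degree (min_poly_rat (poly (map_poly of_rat f) x)) \<le> n"
      using degree_min_poly_rat_value_le[of p x f] p assms by auto
  qed
  then show "z \<in> to_fract ` Int_rat (roots_of_set P) (alg_ints_deg_le n)"
    unfolding z by blast
next
  fix z assume "z \<in> to_fract ` Int_rat (roots_of_set P) (alg_ints_deg_le n)"
  then obtain f where f: "z = to_fract f" "f \<in> Int_rat (roots_of_set P) (alg_ints_deg_le n)"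
    by blast
  show "z \<in> integral_closure (to_fract ` Int_mats n P)"
    using Int_rat_imp_monic_pcompose[OF assms f(2)] to_fract_integral_of_pcompose f(1) by metis
qed

end
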